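(* Let $p,m\ge 1$ be integers. Let $M_{p,m}\subseteq \mathbb{R}[\psi_{ij},\; i\le j]$ be the ideal generated by all $(m+1)\times(m+1)$-minors of the symmetric $p\times p$-matrix $\Psi=(\psi_{ij})$ of indeterminates. Then the ideal of invariants $I_{p,m}$ of the factor analysis model equals $$I_{p,m} \;=\; M_{p,m}\,\cap\,\mathbb{R}[\psi_{ij},\; i<j].$$
   Context: $\mathbb{R}[\psi_{ij},\, i\le j]$ is the polynomial ring in the $\binom{p+1}{2}$ indeterminates $\psi_{ij}$, $1\le i\le j\le p$, regarded as the entries of a symmetric $p\times p$-matrix $\Psi=(\psi_{ij})$ (with $\psi_{ji}=\psi_{ij}$); $\mathbb{R}[\psi_{ij},\, i<j]$ is the subring generated by the off-diagonal indeterminates. The parameter space of the factor analysis model with $p$ observed variables and $m$ factors is $$F_{p,m}=\{\Sigma+\Lambda\Lambda^t\in\mathbb{R}^{p\times p} : \Sigma \text{ diagonal and positive definite},\ \Lambda\in\mathbb{R}^{p\times m}\}.$$ The ideal of invariants $I_{p,m}$ is the ideal of polynomials that vanish at all matrices $\Psi\in F_{p,m}$. It is regarded as an ideal in the subring $\mathbb{R}[\psi_{ij},\, i<j]$, i.e. $I_{p,m}$ is the set of all $f\in\mathbb{R}[\psi_{ij},\, i<j]$ with $f(\Psi)=0$ for all $\Psi\in F_{p,m}$. *)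

theory Defs
  imports
    "HOL-Library.Poly_Mapping"
    "HOL-Algebra.Ideal"
    "Jordan_Normal_Form.Determinant"
    "Jordan_Normal_Form.DL_Submatrix"
begin

text \<open>
  Real polynomials in indeterminates indexed by pairs are finitely supported maps from monomials
  (finitely supported exponent functions) to coefficients, with the convolution product of
  \<^theory>\<open>HOL-Library.Poly_Mapping\<close>. Row and column indices run over \<open>0, \<dots>, p - 1\<close>.
\<close>

type_synonym rpoly = "((nat \<times> nat) \<Rightarrow>\<^sub>0 nat) \<Rightarrow>\<^sub>0 real"

definition indet :: "nat \<times> nat \<Rightarrow> rpoly" where
  "indet v = Poly_Mapping.single (Poly_Mapping.single v 1) 1"

definition indets_of :: "rpoly \<Rightarrow> (nat \<times> nat) set" where
  "indets_of f = (\<Union>t\<in>Poly_Mapping.keys f. Poly_Mapping.keys t)"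

definition poly_eval :: "(nat \<times> nat \<Rightarrow> real) \<Rightarrow> rpoly \<Rightarrow> real" where
  "poly_eval a f =
     (\<Sum>t\<in>Poly_Mapping.keys f.
        Poly_Mapping.lookup f t * (\<Prod>v\<in>Poly_Mapping.keys t. a v ^ Poly_Mapping.lookup t v))"

definition poly_ring :: "(nat \<times> nat) set \<Rightarrow> rpoly ring" where
  "poly_ring V =
     \<lparr> carrier = {f. indets_of f \<subseteq> V}, monoid.mult = (*), one = 1, zero = 0, ring.add = (+) \<rparr>"

definition sym_indets :: "nat \<Rightarrow> (nat \<times> nat) set" where
  "sym_indets p = {(i, j). i \<le> j \<and> j < p}"

definition offdiag_indets :: "nat \<Rightarrow> (nat \<times> nat) set" where
  "offdiag_indets p = {(i, j). i < j \<and> j < p}"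

definition Psi :: "nat \<Rightarrow> rpoly mat" where
  "Psi p = mat p p (\<lambda>(i, j). indet (min i j, max i j))"

definition minors :: "nat \<Rightarrow> 'a :: comm_ring_1 mat \<Rightarrow> 'a set" where
  "minors k A =
     {det (submatrix A I J) | I J.
        I \<subseteq> {..<dim_row A} \<and> J \<subseteq> {..<dim_col A} \<and> card I = k \<and> card J = k}"

definition M_ideal :: "nat \<Rightarrow> nat \<Rightarrow> rpoly set" where
  "M_ideal p m = genideal (poly_ring (sym_indets p)) (minors (m + 1) (Psi p))"

definition positive_definite :: "real mat \<Rightarrow> bool" where
  "positive_definite A \<longleftrightarrow>
     A \<in> carrier_mat (dim_row A) (dim_row A) \<and> A\<^sup>T = A \<and>
     (\<forall>v \<in> carrier_vec (dim_row A). v \<noteq> 0\<^sub>v (dim_row A) \<longrightarrow> v \<bullet> (A *\<^sub>v v) > 0)"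

definition factor_model :: "nat \<Rightarrow> nat \<Rightarrow> real mat set" where
  "factor_model p m =
     {S + L * L\<^sup>T | S L.
        S \<in> carrier_mat p p \<and> diagonal_mat S \<and> positive_definite S \<and> L \<in> carrier_mat p m}"

definition I_ideal :: "nat \<Rightarrow> nat \<Rightarrow> rpoly set" where
  "I_ideal p m =
     {f \<in> carrier (poly_ring (offdiag_indets p)).
        \<forall>A \<in> factor_model p m. poly_eval (\<lambda>(i, j). A $$ (i, j)) f = 0}"

text \<open>
  \<^const>\<open>genideal\<close> is an intersection of ideals and would be \<^const>\<open>UNIV\<close> for generators outside the
  carrier; the next two lemmas rule this out for \<^const>\<open>M_ideal\<close>.
\<close>

lemma cring_poly_ring: "cring (poly_ring V)"
proof -
  have plus: "indets_of (f + g) \<subseteq> V" if "indets_of f \<subseteq> V" "indets_of g \<subseteq> V" for f g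
    using that keys_add[of f g] unfolding indets_of_def by blast
  have times: "indets_of (f * g) \<subseteq> V" if fg: "indets_of f \<subseteq> V" "indets_of g \<subseteq> V" for f g
  proof
    fix v assume "v \<in> indets_of (f * g)"
    then obtain t where t: "t \<in> Poly_Mapping.keys (f * g)" "v \<in> Poly_Mapping.keys t"
      unfolding indets_of_def by blast
    then obtain a b where "t = a + b" "a \<in> Poly_Mapping.keys f" "b \<in> Poly_Mapping.keys g"
      using keys_mult[of f g] by blast
    then show "v \<in> V"
      using t fg keys_add[of a b] unfolding indets_of_def by blast
  qed
  have uminus: "indets_of (- f) \<subseteq> V" if "indets_of f \<subseteq> V" for f
    using that by (simp add: indets_of_def)
  have inv: "\<exists>g\<in>carrier (poly_ring V). g + f = 0" if "f \<in> carrier (poly_ring V)" for f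
    using that uminus[of f] by (intro bexI[of _ "- f"]) (auto simp: poly_ring_def)
  show ?thesis
    by (intro cringI abelian_groupI comm_monoidI)
       (use plus times inv in \<open>auto simp: poly_ring_def indets_of_def algebra_simps\<close>)
qed

lemma minors_subset: "minors k (Psi p) \<subseteq> carrier (poly_ring (sym_indets p))"
proof -
  let ?V = "sym_indets p"
  let ?R = "poly_ring ?V"
  interpret R: cring ?R by (rule cring_poly_ring)
  have one: "1 \<in> carrier ?R" and zero: "0 \<in> carrier ?R"
    using R.one_closed R.zero_closed by (simp_all add: poly_ring_def)
  have plus: "f + g \<in> carrier ?R" and times: "f * g \<in> carrier ?R"
    if "f \<in> carrier ?R" "g \<in> carrier ?R" for f g
    using R.add.m_closed[OF that] R.m_closed[OF that] by (simp_all add: poly_ring_def)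
  have uminus: "- f \<in> carrier ?R" if "f \<in> carrier ?R" for f
    using that by (simp add: poly_ring_def indets_of_def)
  have sum: "sum h X \<in> carrier ?R" if "\<And>x. x \<in> X \<Longrightarrow> h x \<in> carrier ?R" for h and X :: "(nat \<Rightarrow> nat) set"
    using that by (induction X rule: infinite_finite_induct) (auto intro: plus zero)
  have prod: "prod h X \<in> carrier ?R" if "\<And>x. x \<in> X \<Longrightarrow> h x \<in> carrier ?R" for h and X :: "nat set"
    using that by (induction X rule: infinite_finite_induct) (auto intro: times one)
  have entry: "Psi p $$ (i, j) \<in> carrier ?R" if "i < p" "j < p" for i j
    using that
    by (auto simp: Psi_def indet_def poly_ring_def indets_of_def sym_indets_def min_def max_def)
  show ?thesis
  proof
    fix f assume "f \<in> minors k (Psi p)"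
    then obtain I J where IJ: "I \<subseteq> {..<p}" "J \<subseteq> {..<p}" "card I = k" "card J = k"
      and f: "f = det (submatrix (Psi p) I J)"
      by (auto simp: minors_def Psi_def)
    have sub: "{i. i < p \<and> i \<in> I} = I" "{j. j < p \<and> j \<in> J} = J"
      using IJ by auto
    have dims: "dim_row (Psi p) = p" "dim_col (Psi p) = p" by (simp_all add: Psi_def)
    have car: "submatrix (Psi p) I J \<in> carrier_mat k k"
      unfolding carrier_mat_def by (simp add: dim_submatrix dims sub IJ)
    have ent: "submatrix (Psi p) I J $$ (i, j) \<in> carrier ?R" if "i < k" "j < k" for i j
    proof -
      have "pick I i < p" "pick J j < p"
        using that IJ pick_in_set_le[of i I] pick_in_set_le[of j J] by auto
      then show ?thesis
        using that by (subst submatrix_index) (auto simp: dims sub IJ intro: entry)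
    qed
    show "f \<in> carrier ?R"
      unfolding f det_def'[OF car]
    proof (rule sum)
      fix q assume q: "q \<in> {q. q permutes {0..<k}}"
      have P: "(\<Prod>i = 0..<k. submatrix (Psi p) I J $$ (i, q i)) \<in> carrier ?R"
        by (rule prod) (use q permutes_in_image[of q "{0..<k}"] in \<open>auto intro!: ent\<close>)
      show "signof q * (\<Prod>i = 0..<k. submatrix (Psi p) I J $$ (i, q i)) \<in> carrier ?R"
        using P uminus[OF P] by (simp add: sign_def)
    qed
  qed
qed

end

theory Submission
  imports Defs
begin

text \<open>
  A polynomial in the off-diagonal variables lies in \<open>I_ideal p m\<close> iff it vanishes at all matrices
  \<open>\<Lambda>\<Lambda>\<^sup>t\<close>, so the theorem amounts to the fact that the \<open>(m+1)\<close>-minors generate all polynomials vanishing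
  there. Weigh a monomial by the quadrant counts of its configuration of points \<open>(i, j)\<close>, \<open>(j, i)\<close>. The
  diagonal term of a minor has the largest weight among its terms, so modulo the minors every
  polynomial is a combination of standard monomials, those not divisible by such a term. The points of
  a standard monomial split into \<open>m\<close> antichains, and an antichain is the unique configuration of
  least weight with given row sums. Hence the standard monomial of largest weight in a combination
  produces, after substituting \<open>\<psi>\<^sub>i\<^sub>j = \<Sum>\<^sub>c \<lambda>\<^sub>i\<^sub>c \<lambda>\<^sub>j\<^sub>c\<close>, a monomial in the \<open>\<lambda>\<close> that cannot be cancelled.
\<close>

section \<open>Notation and induction for power products\<close>

abbreviation lookup where "lookup \<equiv> Poly_Mapping.lookup"
abbreviation keys where "keys \<equiv> Poly_Mapping.keys"
abbreviation single where "single \<equiv> Poly_Mapping.single"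

text \<open>Induction on the total degree, splitting off one variable at a time.\<close>

lemma power_product_induct [case_names zero plus]:
  fixes t :: "'v \<Rightarrow>\<^sub>0 nat"
  assumes "P 0" and plus: "\<And>t v. P t \<Longrightarrow> P (t + single v 1)"
  shows "P t"
proof (induction "\<Sum>v\<in>keys t. lookup t v" arbitrary: t)
  case 0
  then show ?case
    using \<open>P 0\<close> by (metis finite_keys in_keys_iff keys_eq_empty ex_in_conv sum_eq_0_iff)
next
  case (Suc n)
  then obtain v where v: "v \<in> keys t"
    by (metis Zero_not_Suc ex_in_conv sum.empty)
  define s where "s = t - single v 1"
  have t: "t = s + single v 1"
    using v by (intro poly_mapping_eqI) (auto simp: s_def lookup_add lookup_minus lookup_single when_def in_keys_iff)
  have "(\<Sum>v\<in>keys t. lookup t v) = (\<Sum>v\<in>keys s. lookup s v) + 1"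
    unfolding t by (subst setsum_keys_plus_distrib) auto
  then have "P s" using Suc by simp
  then show ?case unfolding t by (rule plus)
qed

section \<open>Evaluation and substitution\<close>

definition mon_eval :: "('v \<Rightarrow> 'b :: comm_semiring_1) \<Rightarrow> ('v \<Rightarrow>\<^sub>0 nat) \<Rightarrow> 'b" where
  "mon_eval a t = (\<Prod>v\<in>keys t. a v ^ lookup t v)"

lemma mon_eval_superset:
  assumes "finite V" "keys t \<subseteq> V"
  shows "mon_eval a t = (\<Prod>v\<in>V. a v ^ lookup t v)"
  unfolding mon_eval_def using assms by (intro prod.mono_neutral_left) (auto simp: in_keys_iff)

lemma mon_eval_zero [simp]: "mon_eval a 0 = 1"
  by (simp add: mon_eval_def)

lemma mon_eval_single [simp]: "mon_eval a (single v n) = a v ^ n"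
  by (simp add: mon_eval_def)

lemma mon_eval_add: "mon_eval a (s + t) = mon_eval a s * mon_eval a t"
  using keys_add[of s t]
  by (simp add: mon_eval_superset[of "keys s \<union> keys t"] lookup_add power_add prod.distrib)

lemma poly_eval_altdef: "poly_eval a f = (\<Sum>t\<in>keys f. lookup f t * mon_eval a t)"
  by (simp add: poly_eval_def mon_eval_def)

lemma poly_eval_add: "poly_eval a (f + g) = poly_eval a f + poly_eval a g"
  unfolding poly_eval_altdef by (rule setsum_keys_plus_distrib) (auto simp: algebra_simps)

lemma poly_eval_zero [simp]: "poly_eval a 0 = 0"
  by (simp add: poly_eval_altdef)

lemma poly_eval_single: "poly_eval a (single t c) = c * mon_eval a t"
  by (simp add: poly_eval_altdef)

lemma poly_eval_one [simp]: "poly_eval a 1 = 1"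
  by (simp add: poly_eval_altdef)

lemma poly_eval_sum: "poly_eval a (sum f X) = (\<Sum>x\<in>X. poly_eval a (f x))"
  by (induction X rule: infinite_finite_induct) (auto simp: poly_eval_add)

lemma poly_mapping_sum_singles: "f = (\<Sum>t\<in>keys f. single t (lookup f t))"
  by (intro poly_mapping_eqI) (auto simp: lookup_sum lookup_single when_def in_keys_iff)

lemma poly_mapping_mult_expand:
  fixes f g :: "'a :: monoid_add \<Rightarrow>\<^sub>0 'b :: semiring_0"
  shows "f * g = (\<Sum>s\<in>keys f. \<Sum>t\<in>keys g. single (s + t) (lookup f s * lookup g t))"
  by (subst poly_mapping_sum_singles[of f], subst poly_mapping_sum_singles[of g])
    (simp add: sum_product mult_single)

lemma poly_eval_mult: "poly_eval a (f * g) = poly_eval a f * poly_eval a g"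
  unfolding poly_mapping_mult_expand[of f g]
  by (simp add: poly_eval_sum poly_eval_single mon_eval_add)
    (simp add: poly_eval_altdef sum_product algebra_simps)

interpretation poly_eval: comm_ring_hom "poly_eval a"
  by unfold_locales (auto simp: poly_eval_add poly_eval_mult)

lemma poly_eval_indet [simp]: "poly_eval a (indet v) = a v"
  by (simp add: indet_def poly_eval_single)

lemma poly_eval_cong:
  assumes "\<And>v. v \<in> indets_of f \<Longrightarrow> a v = b v"
  shows "poly_eval a f = poly_eval b f"
  unfolding poly_eval_def
proof (intro sum.cong prod.cong arg_cong2[where f = "(*)"] arg_cong2[where f = "(^)"] refl)
  fix t v assume "t \<in> keys f" "v \<in> keys t"
  then show "a v = b v" using assms unfolding indets_of_def by blast
qed

definition subst :: "(nat \<times> nat \<Rightarrow> rpoly) \<Rightarrow> rpoly \<Rightarrow> rpoly" where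
  "subst b f = (\<Sum>t\<in>keys f. single 0 (lookup f t) * mon_eval b t)"

lemma poly_eval_mon_eval: "poly_eval a (mon_eval b t) = mon_eval (\<lambda>v. poly_eval a (b v)) t"
  by (simp add: mon_eval_def poly_eval.hom_prod poly_eval.hom_power)

lemma poly_eval_subst: "poly_eval a (subst b f) = poly_eval (\<lambda>v. poly_eval a (b v)) f"
  by (simp add: subst_def poly_eval_sum poly_eval_mult poly_eval_single poly_eval_mon_eval)
    (simp add: poly_eval_altdef)

lemma lookup_single_zero_mult: "lookup (single 0 c * f) t = c * lookup (f :: 'a :: monoid_add \<Rightarrow>\<^sub>0 'b :: semiring_0) t"
  by (simp add: mult_map_scale_conv_mult[symmetric] Poly_Mapping.map.rep_eq when_def)

lemma lookup_subst: "lookup (subst b f) s = (\<Sum>t\<in>keys f. lookup f t * lookup (mon_eval b t) s)"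
  by (simp add: subst_def lookup_sum lookup_single_zero_mult)

text \<open>With the other values fixed, the sum is a univariate polynomial in the value at
  \<open>v\<close> that vanishes everywhere, so its coefficient in degree \<open>e t v\<close> is
  zero. Only the indices in \<open>S\<close> contribute to it, and their exponents on the remaining
  variables still separate them.\<close>

lemma vanishing_coefficients:
  fixes e :: "'i \<Rightarrow> 'v \<Rightarrow> nat" and c :: "'i \<Rightarrow> real"
  assumes "finite V" "finite T"
    and "\<And>s t. s \<in> T \<Longrightarrow> t \<in> T \<Longrightarrow> \<forall>v\<in>V. e s v = e t v \<Longrightarrow> s = t"
    and "\<And>a. (\<Sum>t\<in>T. c t * (\<Prod>v\<in>V. a v ^ e t v)) = 0"
    and "t \<in> T"
  shows "c t = 0"
  using assms
proof (induction V arbitrary: T t rule: finite_induct)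
  case empty
  then have "T = {t}" by auto
  then show ?case using empty.prems(3) by simp
next
  case (insert v V)
  define S where "S = {s \<in> T. e s v = e t v}"
  have "(\<Sum>s\<in>S. c s * (\<Prod>w\<in>V. a w ^ e s w)) = 0" for a
  proof -
    define q where "q = (\<Sum>s\<in>T. Polynomial.monom (c s * (\<Prod>w\<in>V. a w ^ e s w)) (e s v))"
    have "poly q x = 0" for x
    proof -
      have "(\<Prod>w\<in>V. (a(v := x)) w ^ k w) = (\<Prod>w\<in>V. a w ^ k w)" for k
        using insert.hyps by (intro prod.cong) auto
      then show ?thesis
        using insert.prems(3)[of "a(v := x)"] insert.hyps
        by (simp add: q_def poly_sum poly_monom algebra_simps)
    qed
    then have "coeff q (e t v) = 0"
      using poly_all_0_iff_0[of q] by simp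
    then show ?thesis
      using insert.prems(1) by (simp add: q_def coeff_sum S_def sum.inter_filter)
  qed
  moreover have "s = s'" if "s \<in> S" "s' \<in> S" "\<forall>w\<in>V. e s w = e s' w" for s s'
    using that insert.prems(2)[of s s'] by (auto simp: S_def)
  moreover have "finite S" "t \<in> S"
    using insert.prems by (auto simp: S_def)
  ultimately show ?case using insert.IH[of S t] by blast
qed

lemma poly_eval_eq_zero_imp_zero:
  assumes "\<And>a. poly_eval a f = 0"
  shows "f = 0"
proof (rule poly_mapping_eqI)
  fix t
  define V where "V = indets_of f"
  have V: "finite V" by (simp add: V_def indets_of_def)
  have "poly_eval a f = (\<Sum>t\<in>keys f. lookup f t * (\<Prod>v\<in>V. a v ^ lookup t v))" for a
    unfolding poly_eval_altdef
    by (intro sum.cong arg_cong2[where f = "(*)"] mon_eval_superset V) (auto simp: V_def indets_of_def)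
  then have zero: "(\<Sum>t\<in>keys f. lookup f t * (\<Prod>v\<in>V. a v ^ lookup t v)) = 0" for a
    using assms by metis
  have inj: "s = t" if st: "s \<in> keys f" "t \<in> keys f" "\<forall>v\<in>V. lookup s v = lookup t v" for s t
  proof (rule poly_mapping_eqI)
    fix v
    show "lookup s v = lookup t v"
    proof (cases "v \<in> V")
      case False
      then have "v \<notin> keys s" "v \<notin> keys t" using st by (auto simp: V_def indets_of_def)
      then show ?thesis by (simp add: in_keys_iff)
    qed (use st in auto)
  qed
  have "lookup f t = 0" if "t \<in> keys f"
    by (rule vanishing_coefficients[OF V finite_keys _ _ that, where e = lookup]) (use inj zero in blast)+
  then show "lookup f t = lookup 0 t" by (auto simp: in_keys_iff)
qed


section \<open>Quadrant counts of symmetric point configurations\<close>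

text \<open>All statistics below have this form, so \<open>lin_cong\<close> reduces identities
  between them to identities of indicators for a single variable.\<close>

definition lin :: "('v \<Rightarrow> nat) \<Rightarrow> ('v \<Rightarrow>\<^sub>0 nat) \<Rightarrow> nat" where
  "lin w t = (\<Sum>v\<in>keys t. lookup t v * w v)"

lemma lin_zero [simp]: "lin w 0 = 0"
  by (simp add: lin_def)

lemma lin_single [simp]: "lin w (single v n) = n * w v"
  by (simp add: lin_def)

lemma lin_add: "lin w (s + t) = lin w s + lin w t"
  unfolding lin_def by (rule setsum_keys_plus_distrib) (auto simp: algebra_simps)

lemma lin_sum: "lin w (sum f X) = (\<Sum>x\<in>X. lin w (f x))"
  by (induction X rule: infinite_finite_induct) (auto simp: lin_add)

lemma lin_add_weight: "lin (\<lambda>v. w v + w' v) t = lin w t + lin w' t"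
  by (simp add: lin_def algebra_simps sum.distrib)

lemma lin_sum_weight: "lin (\<lambda>v. \<Sum>i\<in>X. w i v) t = (\<Sum>i\<in>X. lin (w i) t)"
  unfolding lin_def sum_distrib_left by (rule sum.swap)

lemma lin_cong: "(\<And>v. v \<in> keys t \<Longrightarrow> w v = w' v) \<Longrightarrow> lin w t = lin w' t"
  by (simp add: lin_def)

lemma lin_eq_zero: "(\<And>v. v \<in> keys t \<Longrightarrow> w v = 0) \<Longrightarrow> lin w t = 0"
  by (simp add: lin_def)

lemma lin_of_eq: "lin (\<lambda>v. of_bool (v = u)) t = lookup t u"
proof -
  have "lin (\<lambda>v. of_bool (v = u)) t = (\<Sum>v\<in>keys t. if v = u then lookup t v else 0)"
    unfolding lin_def by (intro sum.cong) auto
  then show ?thesis by (auto simp: in_keys_iff)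
qed

text \<open>Row sum of the symmetric configuration, or the degree of the vertex \<open>i\<close>
  when variables are read as edges and diagonal ones as loops.\<close>

abbreviation valency :: "nat \<Rightarrow> (nat \<times> nat \<Rightarrow>\<^sub>0 nat) \<Rightarrow> nat" where
  "valency i \<equiv> lin (\<lambda>v. of_bool (fst v = i) + of_bool (snd v = i))"

text \<open>
  A variable \<open>(i, j)\<close> contributes both points \<open>(i, j)\<close> and \<open>(j, i)\<close>, so a diagonal variable is
  counted twice.
\<close>

abbreviation quad :: "nat \<Rightarrow> nat \<Rightarrow> (nat \<times> nat \<Rightarrow>\<^sub>0 nat) \<Rightarrow> nat" where
  "quad a b \<equiv> lin (\<lambda>v. of_bool (a \<le> fst v \<and> b \<le> snd v) + of_bool (a \<le> snd v \<and> b \<le> fst v))"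

abbreviation low :: "nat \<Rightarrow> nat \<Rightarrow> (nat \<times> nat \<Rightarrow>\<^sub>0 nat) \<Rightarrow> nat" where
  "low a b \<equiv> lin (\<lambda>v. of_bool (fst v < a \<and> snd v < b) + of_bool (snd v < a \<and> fst v < b))"

definition weight :: "nat \<Rightarrow> (nat \<times> nat \<Rightarrow>\<^sub>0 nat) \<Rightarrow> nat" where
  "weight p t = (\<Sum>a<p. \<Sum>b<p. quad a b t)"

lemma weight_add: "weight p (s + t) = weight p s + weight p t"
  by (simp add: weight_def lin_add sum.distrib)

lemma weight_sum: "weight p (sum f X) = (\<Sum>x\<in>X. weight p (f x))"
  by (induction X rule: infinite_finite_induct) (auto simp: weight_add, simp_all add: weight_def)

text \<open>The second clause compares with the mirror image \<open>(l, k)\<close>, so the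
  symmetrised configuration has no two points increasing strictly in both coordinates.\<close>

definition antichain :: "(nat \<times> nat) set \<Rightarrow> bool" where
  "antichain P \<longleftrightarrow> (\<forall>i j k l. (i, j) \<in> P \<and> (k, l) \<in> P \<longrightarrow> \<not> (i < k \<and> j < l) \<and> \<not> (i < l \<and> j < k))"

lemma quadrant_indicator:
  "of_bool (a \<le> x \<and> b \<le> y) + 1 = of_bool (a \<le> x) + of_bool (b \<le> y) + (of_bool (x < a \<and> y < b) :: nat)"
  for a b x y :: nat
  by (cases "a \<le> x"; cases "b \<le> y") auto

text \<open>A single point is the mixed second difference of quadrant indicators, arranged without
  subtraction of naturals.\<close>

lemma corner_indicator:
  "of_bool (Suc a \<le> x \<and> b \<le> y) + of_bool (a \<le> x \<and> Suc b \<le> y) + of_bool ((x, y) = (a, b))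
    = of_bool (a \<le> x \<and> b \<le> y) + (of_bool (Suc a \<le> x \<and> Suc b \<le> y) :: nat)"
  for a b x y :: nat
  by (cases x a rule: linorder_cases; cases y b rule: linorder_cases) auto

text \<open>Inclusion-exclusion: the valencies add up to the number of points, so for given margins
  the counts in opposite quadrants differ by a constant.\<close>

lemma quad_balance:
  assumes "keys t \<subseteq> sym_indets p"
  shows "quad a b t + (\<Sum>i<p. valency i t) =
           (\<Sum>i\<in>{a..<p}. valency i t) + (\<Sum>i\<in>{b..<p}. valency i t) + low a b t"
  unfolding lin_sum_weight[symmetric] lin_add_weight[symmetric]
proof (rule lin_cong)
  fix v assume "v \<in> keys t"
  then have v: "fst v < p" "snd v < p" using assms by (auto simp: sym_indets_def)
  have count: "(\<Sum>i\<in>{c..<p}. of_bool (fst v = i) + of_bool (snd v = i) :: nat)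
      = of_bool (c \<le> fst v) + of_bool (c \<le> snd v)" for c
    using v by (simp add: sum.distrib of_bool_def)
  show "of_bool (a \<le> fst v \<and> b \<le> snd v) + of_bool (a \<le> snd v \<and> b \<le> fst v) +
      (\<Sum>i<p. of_bool (fst v = i) + of_bool (snd v = i)) =
      (\<Sum>i = a..<p. of_bool (fst v = i) + of_bool (snd v = i)) +
      (\<Sum>i = b..<p. of_bool (fst v = i) + of_bool (snd v = i)) +
      (of_bool (fst v < a \<and> snd v < b) + of_bool (snd v < a \<and> fst v < b) :: nat)"
    unfolding lessThan_atLeast0 count
    using quadrant_indicator[of a "fst v" b "snd v"] quadrant_indicator[of a "snd v" b "fst v"]
    by simp
qed

text \<open>
  An antichain has no points in one of two opposite quadrants, so its quadrant counts are the
  least ones compatible with the margins.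
\<close>

lemma quad_antichain_le:
  assumes "keys s \<subseteq> sym_indets p" "keys t \<subseteq> sym_indets p"
    and "\<And>i. valency i s = valency i t" and "antichain (keys s)"
  shows "quad a b s \<le> quad a b t"
proof (cases "quad a b s = 0")
  case False
  then obtain v where v: "v \<in> keys s"
      "a \<le> fst v \<and> b \<le> snd v \<or> a \<le> snd v \<and> b \<le> fst v"
    using lin_eq_zero[of s "\<lambda>v. of_bool (a \<le> fst v \<and> b \<le> snd v) + of_bool (a \<le> snd v \<and> b \<le> fst v)"]
    by fastforce
  have "low a b s = 0"
  proof (rule lin_eq_zero)
    fix w assume "w \<in> keys s"
    then have "\<not> (fst w < fst v \<and> snd w < snd v) \<and> \<not> (fst w < snd v \<and> snd w < fst v)"
      using v(1) assms(4) unfolding antichain_def by (metis prod.collapse)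
    then show "of_bool (fst w < a \<and> snd w < b) + of_bool (snd w < a \<and> fst w < b) = (0 :: nat)"
      using v(2) by auto
  qed
  then show ?thesis
    using quad_balance[OF assms(1), of a b] quad_balance[OF assms(2), of a b] assms(3) by simp
qed simp

text \<open>Mixed second differences of the counts recover the exponent of \<open>(i, j)\<close>
  plus that of \<open>(j, i)\<close>. Keys in \<open>sym_indets p\<close> have ordered indices, so
  this sum determines the exponent.\<close>

lemma eq_of_quad_eq:
  assumes "keys s \<subseteq> sym_indets p" "keys t \<subseteq> sym_indets p"
    and quad: "\<And>a b. quad a b s = quad a b t"
  shows "s = t"
proof (rule poly_mapping_eqI)
  fix v :: "nat \<times> nat"
  obtain i j where v: "v = (i, j)" by (cases v)
  have corner: "quad (Suc i) j u + quad i (Suc j) u + (lookup u (i, j) + lookup u (j, i))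
      = quad i j u + quad (Suc i) (Suc j) u" for u
    unfolding lin_of_eq[symmetric] lin_add_weight[symmetric]
  proof (rule lin_cong)
    fix v
    have "of_bool (v = (j, i)) = (of_bool ((snd v, fst v) = (i, j)) :: nat)"
      by (cases v) auto
    then show "of_bool (Suc i \<le> fst v \<and> j \<le> snd v) + of_bool (Suc i \<le> snd v \<and> j \<le> fst v) +
        (of_bool (i \<le> fst v \<and> Suc j \<le> snd v) + of_bool (i \<le> snd v \<and> Suc j \<le> fst v)) +
        (of_bool (v = (i, j)) + of_bool (v = (j, i))) =
        of_bool (i \<le> fst v \<and> j \<le> snd v) + of_bool (i \<le> snd v \<and> j \<le> fst v) +
        (of_bool (Suc i \<le> fst v \<and> Suc j \<le> snd v) + (of_bool (Suc i \<le> snd v \<and> Suc j \<le> fst v) :: nat))"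
      using corner_indicator[of i "fst v" j "snd v"] corner_indicator[of i "snd v" j "fst v"]
      unfolding prod.collapse by linarith
  qed
  have "lookup s (i, j) + lookup s (j, i) = lookup t (i, j) + lookup t (j, i)"
    using corner[of s] corner[of t] quad[of "Suc i" j] quad[of i "Suc j"] quad[of i j]
      quad[of "Suc i" "Suc j"] by linarith
  moreover have "lookup u (k, l) = 0" if "keys u \<subseteq> sym_indets p" "l < k"
    for u :: "nat \<times> nat \<Rightarrow>\<^sub>0 nat" and k l
  proof -
    have "(k, l) \<notin> keys u" using that by (auto simp: sym_indets_def)
    then show ?thesis by (simp add: in_keys_iff)
  qed
  ultimately show "lookup s v = lookup t v"
    using assms(1,2) by (cases i j rule: linorder_cases) (auto simp: v)
qed

text \<open>Each quadrant count of \<open>s\<close> is at most that of \<open>t\<close>, so equal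
  weights force equal counts at every corner in range. Beyond the range both counts vanish, and the
  counts determine the power product.\<close>

lemma weight_antichain:
  assumes "keys s \<subseteq> sym_indets p" "keys t \<subseteq> sym_indets p"
    and "\<And>i. valency i s = valency i t" and "antichain (keys s)"
  shows "weight p s \<le> weight p t" and "weight p s = weight p t \<Longrightarrow> s = t"
proof -
  note le = quad_antichain_le[OF assms]
  show "weight p s \<le> weight p t"
    unfolding weight_def by (intro sum_mono le)
  assume eq: "weight p s = weight p t"
  have "quad a b s = quad a b t" for a b
  proof (cases "a < p \<and> b < p")
    case True
    then have mem: "a \<in> {..<p}" "b \<in> {..<p}" by simp_all
    have "(\<Sum>b<p. quad a b s) = (\<Sum>b<p. quad a b t)"
      using sum_mono_inv[OF eq[unfolded weight_def] sum_mono[OF le] mem(1) finite_lessThan] .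
    from sum_mono_inv[OF this le mem(2) finite_lessThan] show ?thesis .
  next
    case False
    have "quad a b u = 0" if "keys u \<subseteq> sym_indets p" for u
    proof (rule lin_eq_zero)
      fix v assume "v \<in> keys u"
      then have "fst v < p" "snd v < p" using that by (auto simp: sym_indets_def)
      then show "of_bool (a \<le> fst v \<and> b \<le> snd v) + of_bool (a \<le> snd v \<and> b \<le> fst v) = (0 :: nat)"
        using False by auto
    qed
    from this[OF assms(1)] this[OF assms(2)] show ?thesis by (rule trans[OF _ sym])
  qed
  then show "s = t" by (rule eq_of_quad_eq[OF assms(1,2)])
qed

section \<open>Minors and their diagonal terms\<close>

definition sym_var :: "nat \<Rightarrow> nat \<Rightarrow> nat \<times> nat" where
  "sym_var i j = (min i j, max i j)"

text \<open>For increasing \<open>r\<close> and \<open>s\<close> this is the diagonal term of a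
  minor; \<open>s \<circ> \<pi>\<close> in place of \<open>s\<close> gives its other Leibniz
  terms.\<close>

definition term_of :: "nat \<Rightarrow> (nat \<Rightarrow> nat) \<Rightarrow> (nat \<Rightarrow> nat) \<Rightarrow> (nat \<times> nat \<Rightarrow>\<^sub>0 nat)" where
  "term_of n r s = (\<Sum>k<n. single (sym_var (r k) (s k)) 1)"

lemma quad_term_of:
  "quad a b (term_of n r s) = card {k. k < n \<and> a \<le> r k \<and> b \<le> s k} + card {k. k < n \<and> b \<le> r k \<and> a \<le> s k}"
proof -
  have "quad a b (term_of n r s) = (\<Sum>k<n. of_bool (a \<le> r k \<and> b \<le> s k) + of_bool (b \<le> r k \<and> a \<le> s k))"
    unfolding term_of_def lin_sum by (intro sum.cong) (auto simp: sym_var_def min_def max_def)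
  also have "\<dots> = card {k. k < n \<and> a \<le> r k \<and> b \<le> s k} + card {k. k < n \<and> b \<le> r k \<and> a \<le> s k}"
    by (simp add: sum.distrib Int_def)
  finally show ?thesis .
qed

text \<open>Both conditions on the right cut out final segments of \<open>{..<n}\<close>, and one of
  these contains the other. So the identity attains the smaller of the two sizes, which bounds the
  count for every \<open>\<pi>\<close>.\<close>

lemma card_quadrant_permute_le:
  fixes r s :: "nat \<Rightarrow> nat"
  assumes r: "strict_mono_on {..<n} r" and s: "strict_mono_on {..<n} s" and \<pi>: "\<pi> permutes {..<n}"
  shows "card {k. k < n \<and> a \<le> r k \<and> b \<le> s (\<pi> k)} \<le> card {k. k < n \<and> a \<le> r k \<and> b \<le> s k}"
proof (cases "{k. k < n \<and> a \<le> r k} \<subseteq> {k. k < n \<and> b \<le> s k}")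
  case True
  then show ?thesis by (intro card_mono) auto
next
  case False
  then have "\<exists>l<n. a \<le> r l \<and> \<not> b \<le> s l" by blast
  then obtain l where l: "l < n" "a \<le> r l" "s l < b" by (auto simp: not_le)
  have "a \<le> r k" if "k < n" "b \<le> s k" for k
  proof -
    have "s l < s k" using l(3) that(2) by simp
    then have "l \<le> k" using strict_mono_on_less[OF s, of l k] l(1) that(1) by simp
    then have "r l \<le> r k" using strict_mono_on_leD[OF r, of l k] l(1) that(1) by simp
    then show ?thesis using l(2) by simp
  qed
  then have *: "{k. k < n \<and> a \<le> r k \<and> b \<le> s k} = {k. k < n \<and> b \<le> s k}" by auto
  have "\<pi> ` {k. k < n \<and> a \<le> r k \<and> b \<le> s (\<pi> k)} \<subseteq> {k. k < n \<and> b \<le> s k}"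
    using permutes_in_image[OF \<pi>] by auto
  moreover have "inj_on \<pi> A" for A using permutes_inj[OF \<pi>] by (rule inj_on_subset) simp
  ultimately show ?thesis unfolding * by (intro card_inj_on_le[of \<pi>]) auto
qed

text \<open>No quadrant count grows under \<open>\<pi>\<close>, and one drops: a nontrivial
  \<open>\<pi>\<close> lowers some \<open>k\<close>, and the quadrant with corner
  \<open>(r k, s k)\<close> then loses the index \<open>k\<close>.\<close>

lemma weight_permuted_term_less:
  assumes r: "strict_mono_on {..<n} r" and s: "strict_mono_on {..<n} s"
    and bound: "r ` {..<n} \<subseteq> {..<p}" "s ` {..<n} \<subseteq> {..<p}"
    and \<pi>: "\<pi> permutes {..<n}" "\<pi> \<noteq> id"
  shows "weight p (term_of n r (s \<circ> \<pi>)) < weight p (term_of n r s)"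
proof -
  have le: "quad a b (term_of n r (s \<circ> \<pi>)) \<le> quad a b (term_of n r s)" for a b
    unfolding quad_term_of using card_quadrant_permute_le[OF r s \<pi>(1)] by (auto intro: add_mono)
  obtain k where k: "k < n" "\<pi> k < k"
  proof -
    have "\<exists>k. \<pi> k < k"
    proof (rule ccontr)
      assume "\<not> ?thesis"
      then have "\<And>k. k \<le> \<pi> k" by (meson not_less)
      then have "\<pi> = id" using permutes_natset_ge[OF \<pi>(1)] by simp
      with \<pi>(2) show False by simp
    qed
    then show ?thesis using that permutes_not_in[OF \<pi>(1)] by (metis lessThan_iff nat_neq_iff)
  qed
  have sk: "s (\<pi> k) < s k" using s k by (auto intro: strict_mono_onD)
  have "card {l. l < n \<and> r k \<le> r l \<and> s k \<le> s (\<pi> l)} < card {l. l < n \<and> r k \<le> r l \<and> s k \<le> s l}"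
  proof -
    have up: "r k \<le> r l \<longleftrightarrow> k \<le> l" "s k \<le> s l \<longleftrightarrow> k \<le> l" if "l < n" for l
      using that k r s by (auto simp: strict_mono_on_less_eq)
    have "{l. l < n \<and> r k \<le> r l \<and> s k \<le> s (\<pi> l)} \<subset> {l. l < n \<and> r k \<le> r l \<and> s k \<le> s l}"
    proof (rule psubsetI)
      show "{l. l < n \<and> r k \<le> r l \<and> s k \<le> s (\<pi> l)} \<subseteq> {l. l < n \<and> r k \<le> r l \<and> s k \<le> s l}"
        using up by auto
      show "{l. l < n \<and> r k \<le> r l \<and> s k \<le> s (\<pi> l)} \<noteq> {l. l < n \<and> r k \<le> r l \<and> s k \<le> s l}"
        using k sk by (auto dest!: equalityD2)
    qed
    then show ?thesis by (intro psubset_card_mono) auto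
  qed
  then have "quad (r k) (s k) (term_of n r (s \<circ> \<pi>)) < quad (r k) (s k) (term_of n r s)"
    unfolding quad_term_of using card_quadrant_permute_le[OF r s \<pi>(1), of "s k" "r k"] by simp
  moreover have "r k < p" "s k < p" using bound k by auto
  ultimately show ?thesis unfolding weight_def
    by (intro sum_strict_mono_ex1 ballI sum_mono le bexI[of _ "r k"] bexI[of _ "s k"]) auto
qed

text \<open>The smaller indices \<open>min (r k) (s k)\<close> strictly increase with
  \<open>k\<close>, so the term is squarefree and divides \<open>t\<close> as soon as its variables
  occur in \<open>t\<close>.\<close>

lemma lookup_term_of_le:
  assumes "strict_mono_on {..<n} r" "strict_mono_on {..<n} s"
    and "\<And>k. k < n \<Longrightarrow> sym_var (r k) (s k) \<in> keys t"
  shows "lookup (term_of n r s) v \<le> lookup t v"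
proof -
  have less: "min (r k) (s k) < min (r l) (s l)" if "k < l" "l < n" for k l
    using assms(1,2) that by (auto simp: min_def dest: strict_mono_onD[of _ _ k l])
  have inj: "inj_on (\<lambda>k. sym_var (r k) (s k)) {..<n}"
  proof (rule inj_onI)
    fix k l assume "k \<in> {..<n}" "l \<in> {..<n}" "sym_var (r k) (s k) = sym_var (r l) (s l)"
    then show "k = l"
      using less[of k l] less[of l k] by (cases k l rule: linorder_cases) (auto simp: sym_var_def)
  qed
  have "lookup (term_of n r s) v = card {k\<in>{..<n}. sym_var (r k) (s k) = v}"
    by (simp add: term_of_def lookup_sum lookup_single when_def Int_def sum.If_cases)
  also have "\<dots> \<le> of_bool (v \<in> keys t)"
  proof (cases "v \<in> keys t")
    case True
    have "card {k\<in>{..<n}. sym_var (r k) (s k) = v} \<le> card {v}"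
      using inj by (intro card_inj_on_le[of "\<lambda>k. sym_var (r k) (s k)"]) (auto simp: inj_on_def)
    then show ?thesis using True by simp
  next
    case False
    then have "{k\<in>{..<n}. sym_var (r k) (s k) = v} = {}" using assms(3) by auto
    then show ?thesis by (simp only: card.empty)
  qed
  also have "\<dots> \<le> lookup t v" by (simp add: in_keys_iff)
  finally show ?thesis .
qed

lemma pick_strict_mono_image:
  assumes "strict_mono_on {..<n} r" "k < n"
  shows "pick (r ` {..<n}) k = r k"
proof -
  have "{a \<in> r ` {..<n}. a < r k} = r ` {..<k}"
    using assms by (auto simp: strict_mono_on_less image_iff)
  moreover have "card (r ` {..<k}) = k"
    using assms by (subst card_image) (auto intro!: inj_onI simp: strict_mono_on_eq)
  ultimately show ?thesis
    using pick_card_in_set[of "r k" "r ` {..<n}"] assms by simp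
qed

text \<open>The Leibniz formula. As \<open>Psi p\<close> is symmetric, different
  \<open>\<pi>\<close> can give the same power product; the straightening only needs the diagonal
  term to be strictly heavier than the others.\<close>

lemma minor_expansion:
  assumes r: "strict_mono_on {..<n} r" and s: "strict_mono_on {..<n} s"
    and bound: "r ` {..<n} \<subseteq> {..<p}" "s ` {..<n} \<subseteq> {..<p}"
  shows "(\<Sum>\<pi> | \<pi> permutes {..<n}. single (term_of n r (s \<circ> \<pi>)) (signof \<pi>)) \<in> minors n (Psi p)"
proof -
  let ?I = "r ` {..<n}" and ?J = "s ` {..<n}"
  have dims: "dim_row (Psi p) = p" "dim_col (Psi p) = p" by (simp_all add: Psi_def)
  have card: "card ?I = n" "card ?J = n"
    using r s by (auto simp: card_image strict_mono_on_imp_inj_on)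
  have sub: "{i. i < p \<and> i \<in> ?I} = ?I" "{j. j < p \<and> j \<in> ?J} = ?J" using bound by auto
  have car: "submatrix (Psi p) ?I ?J \<in> carrier_mat n n"
    unfolding carrier_mat_def by (simp add: dim_submatrix dims sub card)
  have "det (submatrix (Psi p) ?I ?J) =
      (\<Sum>\<pi> | \<pi> permutes {..<n}. single (term_of n r (s \<circ> \<pi>)) (signof \<pi>))"
    unfolding det_def'[OF car] atLeast0LessThan
  proof (rule sum.cong)
    fix \<pi> assume "\<pi> \<in> {\<pi>. \<pi> permutes {..<n}}"
    then have \<pi>: "\<pi> k < n" if "k < n" for k using that permutes_in_image[of \<pi> "{..<n}" k] by auto
    have "(\<Prod>k<n. submatrix (Psi p) ?I ?J $$ (k, \<pi> k)) = (\<Prod>k<n. indet (sym_var (r k) (s (\<pi> k))))"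
    proof (rule prod.cong)
      fix k assume k: "k \<in> {..<n}"
      then have "r k < p" "s (\<pi> k) < p" using bound \<pi> by auto
      then show "submatrix (Psi p) ?I ?J $$ (k, \<pi> k) = indet (sym_var (r k) (s (\<pi> k)))"
        using k \<pi> by (subst submatrix_index)
          (auto simp: dims sub card pick_strict_mono_image[OF r] pick_strict_mono_image[OF s] Psi_def sym_var_def)
    qed simp
    also have "\<dots> = single (term_of n r (s \<circ> \<pi>)) 1"
    proof -
      have "(\<Prod>k\<in>K. indet (sym_var (r k) (s (\<pi> k)))) = single (\<Sum>k\<in>K. single (sym_var (r k) ((s \<circ> \<pi>) k)) 1) 1"
        if "finite K" for K
        using that by (induction K rule: finite_induct) (auto simp: indet_def mult_single)
      then show ?thesis by (simp add: term_of_def)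
    qed
    finally show "signof \<pi> * (\<Prod>k<n. submatrix (Psi p) ?I ?J $$ (k, \<pi> k)) =
        single (term_of n r (s \<circ> \<pi>)) (signof \<pi>)"
      by (cases "evenperm \<pi>") (simp_all add: sign_def single_uminus)
  qed simp
  moreover have "det (submatrix (Psi p) ?I ?J) \<in> minors n (Psi p)"
    unfolding minors_def dims using bound card by blast
  ultimately show ?thesis by simp
qed


section \<open>Straightening\<close>

text \<open>
  For strictly increasing \<open>r\<close> and \<open>s\<close> the variables \<open>sym_var (r k) (s k)\<close> are distinct, so the second
  condition says that no diagonal term of an \<open>n\<close>-minor divides \<open>t\<close>.
\<close>

definition standard :: "nat \<Rightarrow> nat \<Rightarrow> (nat \<times> nat \<Rightarrow>\<^sub>0 nat) \<Rightarrow> bool" where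
  "standard p n t \<longleftrightarrow> keys t \<subseteq> sym_indets p \<and>
     \<not> (\<exists>r s. strict_mono_on {..<n} r \<and> strict_mono_on {..<n} s \<and>
           (\<forall>k<n. sym_var (r k) (s k) \<in> keys t))"

section \<open>Closure properties of the ideal of minors\<close>

lemma ideal_M_ideal: "ideal (M_ideal p m) (poly_ring (sym_indets p))"
proof -
  interpret cring "poly_ring (sym_indets p)" by (rule cring_poly_ring)
  show ?thesis unfolding M_ideal_def by (intro genideal_ideal minors_subset)
qed

lemma minors_subset_M_ideal: "minors (m + 1) (Psi p) \<subseteq> M_ideal p m"
proof -
  interpret cring "poly_ring (sym_indets p)" by (rule cring_poly_ring)
  show ?thesis unfolding M_ideal_def by (intro genideal_self minors_subset)
qed

lemma M_ideal_zero: "0 \<in> M_ideal p m"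
  using additive_subgroup.zero_closed[OF ideal.axioms(1)[OF ideal_M_ideal[of p m]]]
  by (simp add: poly_ring_def)

lemma M_ideal_add: "f \<in> M_ideal p m \<Longrightarrow> g \<in> M_ideal p m \<Longrightarrow> f + g \<in> M_ideal p m"
  using additive_subgroup.a_closed[OF ideal.axioms(1)[OF ideal_M_ideal[of p m]], of f g]
  by (simp add: poly_ring_def)

lemma M_ideal_mult:
  "f \<in> M_ideal p m \<Longrightarrow> indets_of g \<subseteq> sym_indets p \<Longrightarrow> g * f \<in> M_ideal p m"
  using ideal.I_l_closed[OF ideal_M_ideal, of f p m g] by (simp add: poly_ring_def)

lemma M_ideal_scale: "f \<in> M_ideal p m \<Longrightarrow> single 0 c * f \<in> M_ideal p m"
  by (rule M_ideal_mult) (auto simp: indets_of_def)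

lemma M_ideal_sum: "(\<And>x. x \<in> X \<Longrightarrow> f x \<in> M_ideal p m) \<Longrightarrow> sum f X \<in> M_ideal p m"
  by (induction X rule: infinite_finite_induct) (auto intro: M_ideal_zero M_ideal_add)

definition straightenable :: "nat \<Rightarrow> nat \<Rightarrow> rpoly \<Rightarrow> bool" where
  "straightenable p m f \<longleftrightarrow> (\<exists>g\<in>M_ideal p m. \<forall>t\<in>keys (f - g). standard p (m + 1) t)"

lemma straightenable_lincomb:
  assumes "finite X" "\<And>x. x \<in> X \<Longrightarrow> straightenable p m (f x)"
  shows "straightenable p m (\<Sum>x\<in>X. single 0 (c x) * f x)"
proof -
  obtain G where G: "\<And>x. x \<in> X \<Longrightarrow> G x \<in> M_ideal p m"
    "\<And>x t. x \<in> X \<Longrightarrow> t \<in> keys (f x - G x) \<Longrightarrow> standard p (m + 1) t"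
    using assms(2) unfolding straightenable_def Bex_def Ball_def by metis
  have "(\<Sum>x\<in>X. single 0 (c x) * G x) \<in> M_ideal p m"
    by (intro M_ideal_sum M_ideal_scale G)
  moreover have "standard p (m + 1) t"
    if t: "t \<in> keys ((\<Sum>x\<in>X. single 0 (c x) * f x) - (\<Sum>x\<in>X. single 0 (c x) * G x))" for t
  proof -
    have "(\<Sum>x\<in>X. c x * lookup (f x - G x) t) \<noteq> 0"
      using t by (simp add: in_keys_iff lookup_minus lookup_sum lookup_single_zero_mult
          sum_subtractf right_diff_distrib)
    then obtain x where "x \<in> X" "c x * lookup (f x - G x) t \<noteq> 0"
      by (rule sum.not_neutral_contains_not_neutral)
    then show ?thesis using G(2)[of x t] by (simp add: in_keys_iff)
  qed
  ultimately show ?thesis unfolding straightenable_def by blast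
qed

lemma straightenable_add_M_ideal:
  assumes "straightenable p m f" "h \<in> M_ideal p m"
  shows "straightenable p m (h + f)"
proof -
  obtain g where "g \<in> M_ideal p m" "\<forall>t\<in>keys (f - g). standard p (m + 1) t"
    using assms(1) unfolding straightenable_def by blast
  then show ?thesis
    unfolding straightenable_def using M_ideal_add[OF assms(2), of g]
    by (intro bexI[of _ "h + g"]) auto
qed

lemma keys_term_of_subset:
  assumes "\<And>k. k < n \<Longrightarrow> r k < p" "\<And>k. k < n \<Longrightarrow> s k < p"
  shows "keys (term_of n r s) \<subseteq> sym_indets p"
proof -
  have "keys (term_of n r s) \<subseteq> (\<Union>k<n. keys (single (sym_var (r k) (s k)) (1 :: nat)))"
    unfolding term_of_def by (rule keys_sum)
  also have "\<dots> \<subseteq> sym_indets p"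
    using assms by (auto simp: sym_var_def sym_indets_def)
  finally show ?thesis .
qed

text \<open>Rewriting by a minor replaces a nonstandard power product by terms of strictly smaller
  weight, and weights are naturals.\<close>

lemma straightenable_single:
  assumes "keys t \<subseteq> sym_indets p"
  shows "straightenable p m (single t 1)"
  using assms
proof (induction "weight p t" arbitrary: t rule: less_induct)
  case less
  show ?case
  proof (cases "standard p (m + 1) t")
    case True
    then show ?thesis
      unfolding straightenable_def by (intro bexI[of _ 0]) (auto simp: M_ideal_zero)
  next
    case False
    define n where "n = m + 1"
    obtain r s where r: "strict_mono_on {..<n} r" and s: "strict_mono_on {..<n} s"
      and rs: "\<And>k. k < n \<Longrightarrow> sym_var (r k) (s k) \<in> keys t"
      using False less.prems unfolding standard_def n_def by blast
    have bound: "r k < p" "s k < p" if "k < n" for k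
      using rs[OF that] less.prems by (auto simp: sym_indets_def sym_var_def)
    define d where "d \<pi> = term_of n r (s \<circ> \<pi>)" for \<pi>
    \<comment> \<open>The cofactor of the diagonal term; \<open>lookup_term_of_le\<close> ensures
      that no exponent is truncated.\<close>
    define u where "u = t - d id"
    have t: "t = u + d id"
      using lookup_term_of_le[OF r s rs]
      by (intro poly_mapping_eqI) (simp add: u_def d_def lookup_add lookup_minus)
    define Q where "Q = {\<pi>. \<pi> permutes {..<n}}"
    have Q: "finite Q" "id \<in> Q" by (simp_all add: Q_def finite_permutations permutes_id)
    define h where "h = (\<Sum>\<pi>\<in>Q. single (d \<pi>) (signof \<pi>) :: rpoly)"
    have ku: "keys u \<subseteq> sym_indets p"
    proof
      fix v assume "v \<in> keys u"
      then have "v \<in> keys t" by (auto simp: u_def in_keys_iff lookup_minus)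
      then show "v \<in> sym_indets p" using less.prems by blast
    qed
    have "h \<in> M_ideal p m"
      using minor_expansion[OF r s] bound minors_subset_M_ideal[of m p]
      unfolding h_def Q_def d_def n_def by blast
    then have "single u 1 * h \<in> M_ideal p m"
      using ku by (intro M_ideal_mult) (auto simp: indets_of_def)
    moreover have "straightenable p m
        (\<Sum>\<pi>\<in>Q - {id}. single 0 (- signof \<pi>) * single (u + d \<pi>) 1)"
    proof (rule straightenable_lincomb)
      fix \<pi> assume "\<pi> \<in> Q - {id}"
      then have \<pi>: "\<pi> permutes {..<n}" "\<pi> \<noteq> id" by (auto simp: Q_def)
      have "weight p (d \<pi>) < weight p (d id)"
        using weight_permuted_term_less[OF r s _ _ \<pi>, of p] bound by (auto simp: d_def)
      moreover have "keys (d \<pi>) \<subseteq> sym_indets p"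
        unfolding d_def using bound permutes_in_image[OF \<pi>(1)] by (intro keys_term_of_subset) auto
      ultimately show "straightenable p m (single (u + d \<pi>) 1)"
        using ku keys_add[of u "d \<pi>"] by (intro less.hyps) (auto simp: t weight_add)
    qed (use Q in simp)
    \<comment> \<open>The multiple of the minor is solved for its diagonal term, whose sign is
      \<open>1\<close>.\<close>
    moreover have "single u 1 * h + (\<Sum>\<pi>\<in>Q - {id}. single 0 (- signof \<pi>) * single (u + d \<pi>) 1)
        = single t 1"
    proof -
      have "single u 1 * h = (\<Sum>\<pi>\<in>Q. single (u + d \<pi>) (signof \<pi>))"
        by (simp add: h_def sum_distrib_left mult_single)
      also have "\<dots> = single t 1 + (\<Sum>\<pi>\<in>Q - {id}. single (u + d \<pi>) (signof \<pi>))"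
        using sum.remove[OF Q, of "\<lambda>\<pi>. single (u + d \<pi>) (signof \<pi> :: real)"] by (simp add: t)
      finally show ?thesis by (simp add: mult_single single_uminus sum_negf del: single_of_int)
    qed
    ultimately show ?thesis
      using straightenable_add_M_ideal by fastforce
  qed
qed

lemma straightenable:
  assumes "indets_of f \<subseteq> sym_indets p"
  shows "straightenable p m f"
proof -
  have "straightenable p m (\<Sum>t\<in>keys f. single 0 (lookup f t) * single t 1)"
    using assms by (intro straightenable_lincomb straightenable_single) (auto simp: indets_of_def)
  then show ?thesis
    using poly_mapping_sum_singles[of f] by (simp add: mult_single)
qed

section \<open>Colouring standard power products\<close>

text \<open>The index counts steps, so the chain ending in \<open>x\<close> has \<open>n + 1\<close>
  points.\<close>

primrec chain_end :: "(nat \<times> nat) set \<Rightarrow> nat \<Rightarrow> nat \<times> nat \<Rightarrow> bool" where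
  "chain_end P 0 x \<longleftrightarrow> x \<in> P"
| "chain_end P (Suc n) x \<longleftrightarrow> x \<in> P \<and> (\<exists>y. chain_end P n y \<and> fst y < fst x \<and> snd y < snd x)"

lemma chain_end_swap:
  assumes "\<And>i j. (i, j) \<in> P \<Longrightarrow> (j, i) \<in> P" and "chain_end P n x"
  shows "chain_end P n (prod.swap x)"
  using assms(2)
proof (induction n arbitrary: x)
  case 0
  then show ?case using assms(1) by (cases x) auto
next
  case (Suc n)
  then obtain y where y: "chain_end P n y" "fst y < fst x" "snd y < snd x" by auto
  have "prod.swap x \<in> P" using Suc.prems assms(1) by (cases x) auto
  then show ?case using Suc.IH[OF y(1)] y(2,3)
    unfolding chain_end.simps by (intro conjI exI[of _ "prod.swap y"]) simp_all
qed

text \<open>Turns a chain into the row and column sequences that \<open>standard\<close> excludes.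
  The endpoint is recorded so that the induction can append the next point.\<close>

lemma chain_end_imp_strict_mono:
  assumes "chain_end P n x"
  shows "\<exists>r s. strict_mono_on {..<Suc n} r \<and> strict_mono_on {..<Suc n} s \<and>
           (\<forall>k<Suc n. (r k, s k) \<in> P) \<and> (r n, s n) = x"
  using assms
proof (induction n arbitrary: x)
  case 0
  then show ?case
    by (intro exI[of _ "\<lambda>_. fst x"] exI[of _ "\<lambda>_. snd x"]) (auto simp: strict_mono_on_def)
next
  case (Suc n)
  then obtain y where y: "chain_end P n y" "fst y < fst x" "snd y < snd x" by auto
  obtain r s where r: "strict_mono_on {..<Suc n} r" and s: "strict_mono_on {..<Suc n} s"
    and rs: "\<And>k. k < Suc n \<Longrightarrow> (r k, s k) \<in> P" "r n = fst y" "s n = snd y"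
    using Suc.IH[OF y(1)] by auto
  have ext: "strict_mono_on {..<Suc (Suc n)} (q(Suc n := z))"
    if q: "strict_mono_on {..<Suc n} q" and "q n < z" for q :: "nat \<Rightarrow> nat" and z
  proof (rule strict_mono_onI)
    fix k l assume kl: "k \<in> {..<Suc (Suc n)}" "l \<in> {..<Suc (Suc n)}" "k < l"
    show "(q(Suc n := z)) k < (q(Suc n := z)) l"
    proof (cases "l = Suc n")
      case True
      have "q k \<le> q n" using kl True by (intro strict_mono_on_leD[OF q]) auto
      then show ?thesis using kl True \<open>q n < z\<close> by auto
    next
      case False
      then show ?thesis using kl strict_mono_onD[OF q, of k l] by auto
    qed
  qed
  show ?case
  proof (intro exI conjI)
    show "strict_mono_on {..<Suc (Suc n)} (r(Suc n := fst x))"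
      using ext[OF r] y rs by simp
    show "strict_mono_on {..<Suc (Suc n)} (s(Suc n := snd x))"
      using ext[OF s] y rs by simp
    show "\<forall>k<Suc (Suc n). ((r(Suc n := fst x)) k, (s(Suc n := snd x)) k) \<in> P"
      using rs(1) Suc.prems by (auto simp: less_Suc_eq)
  qed simp
qed

text \<open>
  Colour a point by the length of the longest strict chain ending in it. Transposition maps
  chains to chains, hence the points \<open>(i, j)\<close> and \<open>(j, i)\<close> of a variable get the same colour.
\<close>

lemma standard_colouring:
  assumes "standard p (Suc m) t"
  obtains N where "t = (\<Sum>c<m. N c)" "\<And>c. keys (N c) \<subseteq> sym_indets p" "\<And>c. antichain (keys (N c))"
proof -
  define P where "P = {(i, j). sym_var i j \<in> keys t}"
  have kt: "keys t \<subseteq> sym_indets p" using assms by (simp add: standard_def)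
  have swap: "chain_end P n (j, i)" if "chain_end P n (i, j)" for n i j
    using chain_end_swap[of P n "(i, j)"] that by (simp add: P_def sym_var_def min.commute max.commute)
  \<comment> \<open>A chain of index at least \<open>m\<close> has at least \<open>m + 1\<close>
    points; its first \<open>m + 1\<close> form an excluded diagonal term.\<close>
  have bound: "n < m" if chain: "chain_end P n x" for n x
  proof (rule ccontr)
    assume "\<not> n < m"
    then have le: "{..<Suc m} \<subseteq> {..<Suc n}" by auto
    obtain r s where "strict_mono_on {..<Suc n} r" "strict_mono_on {..<Suc n} s"
        and rs: "\<And>k. k < Suc n \<Longrightarrow> (r k, s k) \<in> P"
      using chain_end_imp_strict_mono[OF chain] by blast
    then have "strict_mono_on {..<Suc m} r" "strict_mono_on {..<Suc m} s"
      using le by (auto intro: monotone_on_subset)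
    moreover have "\<forall>k<Suc m. sym_var (r k) (s k) \<in> keys t"
      using rs le by (auto simp: P_def)
    ultimately show False using assms unfolding standard_def by blast
  qed
  define colour where "colour x = (GREATEST n. chain_end P n x)" for x
  have le_colour: "n \<le> colour x" if "chain_end P n x" for n x
    unfolding colour_def by (rule Greatest_le_nat[where P = "\<lambda>n. chain_end P n x", OF that]) (rule less_imp_le[OF bound])
  have keys_P: "v \<in> P" if "v \<in> keys t" for v
    using that kt by (cases v) (auto simp: P_def sym_var_def sym_indets_def min_def max_def)
  have colour: "chain_end P (colour v) v" if "v \<in> keys t" for v
    unfolding colour_def
    by (rule GreatestI_nat[where P = "\<lambda>n. chain_end P n v" and k = 0 and b = m])
      (use keys_P[OF that] in \<open>auto intro: less_imp_le bound\<close>)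
  define N where "N c = (\<Sum>v\<in>{v\<in>keys t. colour v = c}. single v (lookup t v))" for c
  have keys_N: "v \<in> keys t \<and> colour v = c" if "v \<in> keys (N c)" for v c
  proof -
    have "keys (N c) \<subseteq> (\<Union>v\<in>{v\<in>keys t. colour v = c}. keys (single v (lookup t v)))"
      unfolding N_def by (rule keys_sum)
    then show ?thesis using that by (auto split: if_splits)
  qed
  show thesis
  proof (rule that[of N])
    have "(\<Sum>c<m. N c) = (\<Sum>v\<in>keys t. single v (lookup t v))"
      unfolding N_def by (rule sum.group) (use bound[OF colour] in auto)
    then show "t = (\<Sum>c<m. N c)" using poly_mapping_sum_singles[of t] by simp
    show "keys (N c) \<subseteq> sym_indets p" for c using keys_N kt by blast
    show "antichain (keys (N c))" for c
      unfolding antichain_def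
    proof (intro allI impI)
      fix i j k l assume "(i, j) \<in> keys (N c) \<and> (k, l) \<in> keys (N c)"
      then have *: "chain_end P c (i, j)" "(k, l) \<in> P" "colour (k, l) = c"
        using keys_N colour keys_P by blast+
      \<comment> \<open>A larger point of the same colour would prolong the chain at
        \<open>(i, j)\<close>. If the mirror image \<open>(l, k)\<close> is the larger one,
        \<open>swap\<close> carries the longer chain to \<open>(k, l)\<close>.\<close>
      have no_step: "\<not> chain_end P (Suc c) (k, l)" using le_colour *(3) by fastforce
      have "(l, k) \<in> P" using swap[of 0 k l] *(2) by simp
      then have "chain_end P (Suc c) (l, k)" if "i < l" "j < k"
        using *(1) that by auto
      then show "\<not> (i < k \<and> j < l) \<and> \<not> (i < l \<and> j < k)"
        using no_step swap[of "Suc c" l k] * by auto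
    qed
  qed
qed

section \<open>The Gram substitution\<close>

text \<open>The entry of \<open>\<Lambda>\<Lambda>\<^sup>t\<close> at \<open>v\<close>. The
  indeterminate \<open>(i, c)\<close> here stands for \<open>\<lambda>\<^sub>i\<^sub>c\<close>, not
  for an entry of \<open>Psi p\<close>.\<close>

definition gram :: "nat \<Rightarrow> nat \<times> nat \<Rightarrow> rpoly" where
  "gram m v = (\<Sum>c<m. indet (fst v, c) * indet (snd v, c))"

lemma gram_altdef: "gram m v = (\<Sum>c<m. single (single (fst v, c) 1 + single (snd v, c) 1) 1)"
  by (simp add: gram_def indet_def mult_single)

lemma lookup_mult_expand:
  fixes f g :: "'a :: monoid_add \<Rightarrow>\<^sub>0 'b :: semiring_0"
  shows "lookup (f * g) u =
    (\<Sum>s\<in>keys f. \<Sum>t\<in>keys g. if s + t = u then lookup f s * lookup g t else 0)"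
  by (subst poly_mapping_mult_expand) (simp add: lookup_sum lookup_single when_def)

lemma lookup_mult_nonneg:
  fixes f g :: "'a :: monoid_add \<Rightarrow>\<^sub>0 real"
  assumes "\<And>t. 0 \<le> lookup f t" "\<And>t. 0 \<le> lookup g t"
  shows "0 \<le> lookup (f * g) u"
  unfolding lookup_mult_expand using assms by (intro sum_nonneg) auto

text \<open>With nonnegative coefficients nothing cancels, so one positive contribution
  suffices.\<close>

lemma lookup_mult_pos:
  fixes f g :: "'a :: monoid_add \<Rightarrow>\<^sub>0 real"
  assumes "\<And>t. 0 \<le> lookup f t" "\<And>t. 0 \<le> lookup g t" and pos: "0 < lookup f s" "0 < lookup g t"
  shows "0 < lookup (f * g) (s + t)"
proof -
  let ?F = "\<lambda>s' t'. if s' + t' = s + t then lookup f s' * lookup g t' else 0"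
  have st: "s \<in> keys f" "t \<in> keys g" using pos by (auto simp: in_keys_iff)
  have nonneg: "0 \<le> ?F s' t'" for s' t' using assms(1,2) by simp
  have "0 < (\<Sum>t'\<in>keys g. ?F s t')"
    by (rule sum_pos2[OF finite_keys st(2)]) (use pos nonneg in auto)
  then have "0 < (\<Sum>s'\<in>keys f. \<Sum>t'\<in>keys g. ?F s' t')"
    by (rule sum_pos2[OF finite_keys st(1)]) (use nonneg in \<open>auto intro!: sum_nonneg\<close>)
  then show ?thesis unfolding lookup_mult_expand .
qed

lemma gram_nonneg: "0 \<le> lookup (gram m v) u"
  by (auto simp: gram_altdef lookup_sum lookup_single when_def intro!: sum_nonneg)

lemma gram_pos:
  assumes "c < m"
  shows "0 < lookup (gram m v) (single (fst v, c) 1 + single (snd v, c) 1)"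
  unfolding gram_altdef lookup_sum
  by (rule sum_pos2[where i = c]) (use assms in \<open>auto simp: lookup_single when_def\<close>)

lemma mon_eval_gram_nonneg: "0 \<le> lookup (mon_eval (gram m) t) u"
proof (induction t arbitrary: u rule: power_product_induct)
  case zero
  then show ?case by (simp add: lookup_one when_def)
next
  case (plus t v)
  then show ?case
    unfolding mon_eval_add mon_eval_single power_one_right
    by (intro lookup_mult_nonneg gram_nonneg)
qed

text \<open>Expanding the product picks a column for each factor, and \<open>N c\<close> collects
  the variables that picked \<open>c\<close>. A variable \<open>(i, j)\<close> in \<open>N c\<close>
  contributes \<open>(i, c)\<close> and \<open>(j, c)\<close>, so exponents are valencies.\<close>

lemma colouring_of_gram_key:
  assumes "u \<in> keys (mon_eval (gram m) t)"
  shows "\<exists>N. t = (\<Sum>c<m. N c) \<and> (\<forall>c<m. \<forall>i. lookup u (i, c) = valency i (N c))"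
  using assms
proof (induction t arbitrary: u rule: power_product_induct)
  case zero
  then show ?case by (intro exI[of _ "\<lambda>_. 0"]) auto
next
  case (plus t v)
  have "mon_eval (gram m) (t + single v 1) = mon_eval (gram m) t * gram m v"
    unfolding mon_eval_add mon_eval_single power_one_right ..
  then obtain u1 u2 where u: "u = u1 + u2" "u1 \<in> keys (mon_eval (gram m) t)" "u2 \<in> keys (gram m v)"
    using plus.prems keys_mult[of "mon_eval (gram m) t" "gram m v"] by auto
  obtain N where N: "t = (\<Sum>c<m. N c)" "\<And>c i. c < m \<Longrightarrow> lookup u1 (i, c) = valency i (N c)"
    using plus.IH[OF u(2)] by blast
  have "keys (gram m v) \<subseteq> (\<Union>c<m. keys (single (single (fst v, c) 1 + single (snd v, c) 1 :: nat \<times> nat \<Rightarrow>\<^sub>0 nat) (1 :: real)))"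
    unfolding gram_altdef by (rule keys_sum)
  then obtain d where d: "d < m" "u2 = single (fst v, d) 1 + single (snd v, d) 1"
    using u(3) by auto
  define N' where "N' c = N c + (if c = d then single v 1 else 0)" for c
  have "t + single v 1 = (\<Sum>c<m. N' c)"
    using d(1) by (simp add: N'_def sum.distrib N(1))
  moreover have "lookup u (i, c) = valency i (N' c)" if "c < m" for c i
    using N(2)[OF that] by (auto simp: u(1) d(2) N'_def lookup_add lookup_single when_def lin_add)
  ultimately show ?case by blast
qed

lemma gram_key_of_monochromatic:
  assumes "c < m"
  shows "\<exists>u. 0 < lookup (mon_eval (gram m) t) u \<and>
           (\<forall>i d. lookup u (i, d) = (if d = c then valency i t else 0))"
proof (induction t rule: power_product_induct)
  case zero
  then show ?case by (intro exI[of _ 0]) auto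
next
  case (plus t v)
  then obtain u where u: "0 < lookup (mon_eval (gram m) t) u"
    "\<And>i d. lookup u (i, d) = (if d = c then valency i t else 0)" by blast
  let ?u = "u + (single (fst v, c) 1 + single (snd v, c) 1)"
  have "0 < lookup (mon_eval (gram m) (t + single v 1)) ?u"
    unfolding mon_eval_add mon_eval_single power_one_right
    by (intro lookup_mult_pos mon_eval_gram_nonneg gram_nonneg u(1) gram_pos assms)
  moreover have "lookup ?u (i, d) = (if d = c then valency i (t + single v 1) else 0)" for i d
    using u(2)[of i d] by (auto simp: lookup_add lookup_single when_def lin_add)
  ultimately show ?case by blast
qed

text \<open>Converse of \<open>colouring_of_gram_key\<close>: the factors in \<open>N c\<close> all
  pick column \<open>c\<close>. The bound \<open>k\<close> lets the induction add one colour at a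
  time.\<close>

lemma gram_key_of_colouring:
  assumes "k \<le> m"
  shows "\<exists>u. 0 < lookup (mon_eval (gram m) (\<Sum>c<k. N c)) u \<and>
           (\<forall>i d. lookup u (i, d) = (if d < k then valency i (N d) else 0))"
  using assms
proof (induction k)
  case 0
  then show ?case by (intro exI[of _ 0]) auto
next
  case (Suc k)
  obtain u1 where u1: "0 < lookup (mon_eval (gram m) (\<Sum>c<k. N c)) u1"
    "\<And>i d. lookup u1 (i, d) = (if d < k then valency i (N d) else 0)"
    using Suc by auto
  obtain u2 where u2: "0 < lookup (mon_eval (gram m) (N k)) u2"
    "\<And>i d. lookup u2 (i, d) = (if d = k then valency i (N k) else 0)"
    using gram_key_of_monochromatic[of k m "N k"] Suc.prems by auto
  have "0 < lookup (mon_eval (gram m) (\<Sum>c<Suc k. N c)) (u1 + u2)"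
    unfolding sum.lessThan_Suc mon_eval_add
    by (intro lookup_mult_pos mon_eval_gram_nonneg u1(1) u2(1))
  moreover have "lookup (u1 + u2) (i, d) = (if d < Suc k then valency i (N d) else 0)" for i d
    by (auto simp: lookup_add u1(2) u2(2))
  ultimately show ?case by blast
qed

text \<open>
  The colouring of a standard power product of maximal weight yields a monomial of the
  substituted polynomial to which no other standard power product contributes.
\<close>

lemma standard_independent:
  assumes std: "\<And>t. t \<in> keys f \<Longrightarrow> standard p (Suc m) t" and zero: "subst (gram m) f = 0"
  shows "f = 0"
proof (rule ccontr)
  assume "f \<noteq> 0"
  then have ne: "keys f \<noteq> {}" by simp
  define w where "w = Max (weight p ` keys f)"
  have "w \<in> weight p ` keys f" unfolding w_def using ne by (intro Max_in) auto
  then obtain t where t: "t \<in> keys f" "w = weight p t" by auto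
  have max: "weight p t' \<le> weight p t" if "t' \<in> keys f" for t'
    unfolding t(2)[symmetric] w_def using that by simp
  obtain N where N: "t = (\<Sum>c<m. N c)" "\<And>c. keys (N c) \<subseteq> sym_indets p" "\<And>c. antichain (keys (N c))"
    using standard_colouring[OF std[OF t(1)]] by metis
  obtain u where u: "0 < lookup (mon_eval (gram m) t) u"
    "\<And>i c. c < m \<Longrightarrow> lookup u (i, c) = valency i (N c)"
    using gram_key_of_colouring[of m m N] N(1) by auto
  have "lookup f t' * lookup (mon_eval (gram m) t') u = 0" if t': "t' \<in> keys f - {t}" for t'
  proof (rule ccontr)
    assume "\<not> ?thesis"
    then have "u \<in> keys (mon_eval (gram m) t')" by (simp add: in_keys_iff)
    then obtain N' where N': "t' = (\<Sum>c<m. N' c)" "\<And>c i. c < m \<Longrightarrow> lookup u (i, c) = valency i (N' c)"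
      using colouring_of_gram_key by blast
    have kt': "keys t' \<subseteq> sym_indets p" using std t' by (auto simp: standard_def)
    have sym: "keys (N' c) \<subseteq> sym_indets p" if c: "c < m" for c
    proof
      fix v assume v: "v \<in> keys (N' c)"
      have "lookup (N' c) v \<le> (\<Sum>d<m. lookup (N' d) v)" using c by (intro member_le_sum) auto
      moreover have "lookup (N' c) v \<noteq> 0" using v by (simp add: in_keys_iff)
      ultimately have "lookup t' v \<noteq> 0" unfolding N'(1) lookup_sum by linarith
      then have "v \<in> keys t'" by (simp only: in_keys_iff not_False_eq_True)
      then show "v \<in> sym_indets p" using kt' by blast
    qed
    have val: "valency i (N c) = valency i (N' c)" if "c < m" for i c
      using u(2)[OF that, of i] N'(2)[OF that, of i] by simp
    have le: "weight p (N c) \<le> weight p (N' c)" if "c < m" for c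
      by (rule weight_antichain(1)[OF N(2) sym[OF that] val[OF that] N(3)])
    \<comment> \<open>Each antichain \<open>N c\<close> is lightest for its margins, while
      \<open>t\<close> is heaviest among the keys of \<open>f\<close>. So the totals agree, and
      equality holds colour by colour.\<close>
    have "(\<Sum>c<m. weight p (N c)) = (\<Sum>c<m. weight p (N' c))"
    proof (rule antisym)
      show "(\<Sum>c<m. weight p (N c)) \<le> (\<Sum>c<m. weight p (N' c))"
        by (rule sum_mono) (use le in simp)
      show "(\<Sum>c<m. weight p (N' c)) \<le> (\<Sum>c<m. weight p (N c))"
        using max[of t'] t' by (simp add: weight_sum[symmetric] N(1)[symmetric] N'(1)[symmetric])
    qed
    from sum_mono_inv[OF this le] have eq: "weight p (N c) = weight p (N' c)" if "c < m" for c
      using that by simp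
    have "N c = N' c" if "c < m" for c
      by (rule weight_antichain(2)[OF N(2) sym[OF that] val[OF that] N(3) eq[OF that]])
    then have "t = t'" unfolding N(1) N'(1) by (intro sum.cong) simp_all
    then show False using t' by simp
  qed
  then have "(\<Sum>t'\<in>keys f - {t}. lookup f t' * lookup (mon_eval (gram m) t') u) = 0"
    by (intro sum.neutral ballI)
  then have "lookup (subst (gram m) f) u = lookup f t * lookup (mon_eval (gram m) t) u"
    unfolding lookup_subst sum.remove[OF finite_keys t(1)] by simp
  moreover have "lookup f t \<noteq> 0" using t(1) by (simp add: in_keys_iff)
  ultimately show False using u(1) zero by simp
qed

section \<open>The ideal of minors and the ideal of invariants\<close>

definition gram_eval :: "nat \<Rightarrow> (nat \<times> nat \<Rightarrow> real) \<Rightarrow> nat \<times> nat \<Rightarrow> real" where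
  "gram_eval m a v = (\<Sum>c<m. a (fst v, c) * a (snd v, c))"

lemma poly_eval_subst_gram: "poly_eval a (subst (gram m) f) = poly_eval (gram_eval m a) f"
  by (simp add: poly_eval_subst gram_def gram_eval_def[abs_def] poly_eval_sum poly_eval_mult)

text \<open>Padding with zeros to square matrices keeps the product. Row \<open>m\<close> of
  \<open>B'\<close> is zero, and every Leibniz product of \<open>B'\<close> contains an entry of
  it.\<close>

lemma det_mult_low_rank:
  fixes A B :: "'a :: idom mat"
  assumes "A \<in> carrier_mat n m" "B \<in> carrier_mat m n" "m < n"
  shows "det (A * B) = 0"
proof -
  define A' where "A' = mat n n (\<lambda>(i, j). if j < m then A $$ (i, j) else 0)"
  define B' where "B' = mat n n (\<lambda>(i, j). if i < m then B $$ (i, j) else 0)"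
  have car: "A' \<in> carrier_mat n n" "B' \<in> carrier_mat n n" by (simp_all add: A'_def B'_def)
  have "A * B = A' * B'"
  proof (rule eq_matI)
    fix i j assume "i < dim_row (A' * B')" "j < dim_col (A' * B')"
    then have ij: "i < n" "j < n" by (simp_all add: A'_def B'_def)
    have "(A' * B') $$ (i, j) = (\<Sum>k = 0..<n. (if k < m then A $$ (i, k) else 0) * (if k < m then B $$ (k, j) else 0))"
      using ij by (simp add: A'_def B'_def scalar_prod_def)
    also have "\<dots> = (\<Sum>k = 0..<m. A $$ (i, k) * B $$ (k, j))"
      using assms(3) by (intro sum.mono_neutral_cong_right) auto
    also have "\<dots> = (A * B) $$ (i, j)"
      using ij assms(1,2) by (simp add: scalar_prod_def)
    finally show "(A * B) $$ (i, j) = (A' * B') $$ (i, j)" ..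
  qed (use assms in \<open>auto simp: A'_def B'_def\<close>)
  moreover have "det B' = 0"
  proof -
    have "(\<Prod>i = 0..<n. B' $$ (i, q i)) = 0" if "q permutes {0..<n}" for q
      using assms(3) permutes_in_image[OF that, of m]
      by (intro prod_zero bexI[of _ m]) (auto simp: B'_def)
    then show ?thesis unfolding det_def'[OF car(2)] by (intro sum.neutral) auto
  qed
  ultimately show ?thesis using det_mult[OF car] by simp
qed

text \<open>At a Gram matrix the submatrix factors through dimension \<open>m\<close>.\<close>

lemma poly_eval_minor_gram:
  assumes "g \<in> minors (m + 1) (Psi p)"
  shows "poly_eval (gram_eval m a) g = 0"
proof -
  obtain I J where IJ: "I \<subseteq> {..<p}" "J \<subseteq> {..<p}" "card I = m + 1" "card J = m + 1"
    and g: "g = det (submatrix (Psi p) I J)"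
    using assms by (auto simp: minors_def Psi_def)
  have sub: "{i. i < p \<and> i \<in> I} = I" "{j. j < p \<and> j \<in> J} = J" using IJ by auto
  have dims: "dim_row (Psi p) = p" "dim_col (Psi p) = p" by (simp_all add: Psi_def)
  define A where "A = mat (m + 1) m (\<lambda>(k, c). a (pick I k, c))"
  define B where "B = mat m (m + 1) (\<lambda>(c, k). a (pick J k, c))"
  have "map_mat (poly_eval (gram_eval m a)) (submatrix (Psi p) I J) = A * B"
  proof (rule eq_matI)
    fix k l assume "k < dim_row (A * B)" "l < dim_col (A * B)"
    then have kl: "k < m + 1" "l < m + 1" by (simp_all add: A_def B_def)
    then have "pick I k < p" "pick J l < p"
      using IJ pick_in_set_le[of k I] pick_in_set_le[of l J] by auto
    then have "submatrix (Psi p) I J $$ (k, l) = indet (sym_var (pick I k) (pick J l))"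
      using kl by (subst submatrix_index) (auto simp: dims sub IJ Psi_def sym_var_def)
    then have "map_mat (poly_eval (gram_eval m a)) (submatrix (Psi p) I J) $$ (k, l)
        = gram_eval m a (sym_var (pick I k) (pick J l))"
      using kl by (simp add: dim_submatrix dims sub IJ)
    also have "\<dots> = (\<Sum>c<m. a (pick I k, c) * a (pick J l, c))"
      by (auto simp: gram_eval_def sym_var_def min_def max_def mult.commute)
    also have "\<dots> = (A * B) $$ (k, l)"
      using kl by (simp add: A_def B_def scalar_prod_def atLeast0LessThan)
    finally show "map_mat (poly_eval (gram_eval m a)) (submatrix (Psi p) I J) $$ (k, l) = (A * B) $$ (k, l)" .
  qed (simp_all add: A_def B_def dim_submatrix dims sub IJ)
  then have "poly_eval (gram_eval m a) g = det (A * B)"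
    unfolding g poly_eval.hom_det[symmetric] by simp
  also have "\<dots> = 0"
    by (rule det_mult_low_rank[where m = m and n = "m + 1"]) (auto simp: A_def B_def)
  finally show ?thesis .
qed

text \<open>The polynomials vanishing at a Gram matrix form an ideal that contains the
  minors.\<close>

lemma poly_eval_M_ideal_gram:
  assumes "g \<in> M_ideal p m"
  shows "poly_eval (gram_eval m a) g = 0"
proof -
  let ?R = "poly_ring (sym_indets p)"
  let ?J = "{g \<in> carrier ?R. poly_eval (gram_eval m a) g = 0}"
  interpret R: cring ?R by (rule cring_poly_ring)
  have closed: "f + g \<in> carrier ?R" "f * g \<in> carrier ?R" if "f \<in> carrier ?R" "g \<in> carrier ?R" for f g
    using R.add.m_closed[OF that] R.m_closed[OF that] by (simp_all add: poly_ring_def)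
  have ainv: "\<ominus>\<^bsub>?R\<^esub> f = - f" if "f \<in> carrier ?R" for f
  proof (rule R.minus_equality)
    show "- f \<in> carrier ?R" using that by (simp add: poly_ring_def indets_of_def)
  qed (use that in \<open>simp_all add: poly_ring_def\<close>)
  have "ideal ?J ?R"
  proof (rule idealI)
    show "ring ?R" by (rule R.ring_axioms)
    have "\<ominus>\<^bsub>?R\<^esub> f \<in> ?J" if "f \<in> ?J" for f
      using that R.a_inv_closed[of f] by (simp add: ainv poly_eval.hom_uminus)
    then show "subgroup ?J (add_monoid ?R)"
      using closed R.zero_closed
      by (intro R.add.subgroupI) (auto simp: a_inv_def[symmetric] poly_ring_def poly_eval_add)
  qed (use closed in \<open>auto simp: poly_ring_def poly_eval_mult\<close>)
  moreover have "minors (m + 1) (Psi p) \<subseteq> ?J"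
    using minors_subset poly_eval_minor_gram by auto
  ultimately have "M_ideal p m \<subseteq> ?J"
    unfolding M_ideal_def by (rule R.genideal_minimal)
  then show ?thesis using assms by auto
qed

section \<open>Evaluation on the factor model\<close>

lemma positive_definite_one: "positive_definite (1\<^sub>m p)"
  unfolding positive_definite_def
proof (intro conjI ballI impI)
  fix v :: "real vec" assume v: "v \<in> carrier_vec (dim_row (1\<^sub>m p :: real mat))" "v \<noteq> 0\<^sub>v (dim_row (1\<^sub>m p :: real mat))"
  then obtain i where i: "i < p" "v $ i \<noteq> 0" by (auto simp: vec_eq_iff)
  have "0 < (\<Sum>i = 0..<p. v $ i * v $ i)"
    by (rule sum_pos2[of _ i]) (use i in \<open>auto simp: zero_less_mult_iff linorder_neq_iff\<close>)
  then show "0 < v \<bullet> (1\<^sub>m p *\<^sub>v v)" using v(1) by (simp add: scalar_prod_def)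
qed simp_all

text \<open>The summand \<open>S\<close> changes only diagonal entries, which \<open>f\<close> does
  not involve.\<close>

lemma poly_eval_factor_model:
  assumes f: "indets_of f \<subseteq> offdiag_indets p"
    and S: "S \<in> carrier_mat p p" "diagonal_mat S" and L: "L \<in> carrier_mat p m"
    and a: "\<And>i c. i < p \<Longrightarrow> c < m \<Longrightarrow> a (i, c) = L $$ (i, c)"
  shows "poly_eval (\<lambda>(i, j). (S + L * L\<^sup>T) $$ (i, j)) f = poly_eval (gram_eval m a) f"
proof (rule poly_eval_cong)
  fix v assume "v \<in> indets_of f"
  then obtain i j where v: "v = (i, j)" "i < j" "j < p"
    using f by (auto simp: offdiag_indets_def)
  then have "S $$ (i, j) = 0" using S by (auto simp: diagonal_mat_def)
  then show "(case v of (i, j) \<Rightarrow> (S + L * L\<^sup>T) $$ (i, j)) = gram_eval m a v"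
    using v S L a by (simp add: gram_eval_def scalar_prod_def atLeast0LessThan)
qed

theorem theorem7:
  fixes p m :: nat
  assumes "p \<ge> 1" and "m \<ge> 1"
  shows "I_ideal p m = M_ideal p m \<inter> carrier (poly_ring (offdiag_indets p))"
proof (intro equalityI subsetI)
  fix f assume f: "f \<in> I_ideal p m"
  then have off: "indets_of f \<subseteq> offdiag_indets p" by (simp add: I_ideal_def poly_ring_def)
  then have "indets_of f \<subseteq> sym_indets p" by (auto simp: offdiag_indets_def sym_indets_def)
  then obtain g where g: "g \<in> M_ideal p m" "\<And>t. t \<in> keys (f - g) \<Longrightarrow> standard p (Suc m) t"
    using straightenable[of f p m] unfolding straightenable_def by auto
  have "poly_eval a (subst (gram m) (f - g)) = 0" for a
  proof -
    define L where "L = mat p m a"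
    have L: "L \<in> carrier_mat p m" by (simp add: L_def)
    \<comment> \<open>The identity serves as the positive definite diagonal summand, so every Gram
      matrix is reached up to its diagonal.\<close>
    have "1\<^sub>m p + L * L\<^sup>T \<in> factor_model p m"
      unfolding factor_model_def using L positive_definite_one
      by (intro CollectI exI[of _ "1\<^sub>m p"] exI[of _ L]) (auto simp: diagonal_mat_def)
    then have "poly_eval (\<lambda>(i, j). (1\<^sub>m p + L * L\<^sup>T) $$ (i, j)) f = 0"
      using f unfolding I_ideal_def by blast
    then have "poly_eval (gram_eval m a) f = 0"
      using poly_eval_factor_model[OF off one_carrier_mat _ L, of a] by (simp add: diagonal_mat_def L_def)
    then show ?thesis
      unfolding poly_eval_subst_gram using poly_eval_M_ideal_gram[OF g(1)] by (simp add: poly_eval.hom_minus)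
  qed
  \<comment> \<open>A combination of standard power products that vanishes at all Gram matrices is
    zero, so \<open>f\<close> equals its part \<open>g\<close> in the ideal.\<close>
  then have "f - g = 0"
    using standard_independent[OF g(2) poly_eval_eq_zero_imp_zero] by blast
  then show "f \<in> M_ideal p m \<inter> carrier (poly_ring (offdiag_indets p))"
    using g(1) off by (simp add: poly_ring_def)
next
  fix f assume f: "f \<in> M_ideal p m \<inter> carrier (poly_ring (offdiag_indets p))"
  then have off: "indets_of f \<subseteq> offdiag_indets p" by (simp add: poly_ring_def)
  have "poly_eval (\<lambda>(i, j). A $$ (i, j)) f = 0" if "A \<in> factor_model p m" for A
  proof -
    obtain S L where A: "A = S + L * L\<^sup>T" and S: "S \<in> carrier_mat p p" "diagonal_mat S"
      and L: "L \<in> carrier_mat p m"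
      using \<open>A \<in> factor_model p m\<close> by (auto simp: factor_model_def)
    show ?thesis
      unfolding A poly_eval_factor_model[OF off S L, of "\<lambda>v. L $$ v", OF refl]
      using f by (intro poly_eval_M_ideal_gram[of f p m]) simp
  qed
  then show "f \<in> I_ideal p m" using f by (simp add: I_ideal_def)
qed


end
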